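(* Let $(X,\mathcal B,\mu,f,T_f)$ be a composition dynamical system, with $T_f:L^p(X)\to L^p(X)$, $1\le p<\infty$ (in parts (2) and (4), which concern two-sided notions, $T_f$ is invertible in the sense recalled in the context). Let $\mathcal B^+=\{B\in\mathcal B: 0<\mu(B)<\infty\}$. The following statements hold. (1) $T_f$ is positively expansive if and only if for each $B\in\mathcal B$ with positive measure, $\sup_{n\in\mathbb N}\mu(f^{-n}(B))=\infty$. (2) $T_f$ is expansive if and only if for each $B\in\mathcal B$ with positive measure, $\sup_{n\in\mathbb Z}\mu(f^{-n}(B))=\infty$. (3) $T_f$ is uniformly positively expansive if and only if $$\lim_{n\to\infty}\frac{\mu(f^{-n}(B))}{\mu(B)}=\infty$$ uniformly with respect to $B\in\mathcal B^+$. (4) $T_f$ is uniformly expansive if and only if $\mathcal B^+$ can be split as $\mathcal B^+=\mathcal B^+_{\mathcal A}\cup\mathcal B^+_{\mathcal C}$, where $$\lim_{n\to\infty}\frac{\mu(f^{n}(B))}{\mu(B)}=\infty\quad\text{uniformly on }\mathcal B^+_{\mathcal A},$$ $$\lim_{n\to\infty}\frac{\mu(f^{-n}(B))}{\mu(B)}=\infty\quad\text{uniformly on }\mathcal B^+_{\mathcal C}.$$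
   Context: $\mathbb N$ is the set of positive integers. All Banach spaces are complex. A composition dynamical system is a quintuple $(X,\mathcal B,\mu,f,T_f)$ where: $(X,\mathcal B,\mu)$ is a $\sigma$-finite measure space; $f:X\to X$ is an injective bimeasurable transformation, i.e. $f(B)\in\mathcal B$ and $f^{-1}(B)\in\mathcal B$ for every $B\in\mathcal B$; there is $c>0$ such that $\mu(f^{-1}(B))\le c\,\mu(B)$ for every $B\in\mathcal B$; and $T_f:L^p(X)\to L^p(X)$, $1\le p<\infty$, is the composition operator $T_f\varphi=\varphi\circ f$ (a bounded linear operator). Invertibility of $T_f$: $f$ is also surjective and there is $c'>0$ such that $\mu(f(B))\le c'\mu(B)$ for every $B\in\mathcal B$; then $T_f^{-1}=T_{f^{-1}}$ is bounded. A bounded operator $T$ on a Banach space (invertible in the two-sided, i.e. not "positive", notions) is: - expansive (resp. positively expansive) if for each $x$ with $\|x\|=1$ there exists $n\in\mathbb Z$ (resp. $n\in\mathbb N$) with $\|T^nx\|\ge2$; - uniformly expansive if there exists $n\in\mathbb N$ such that for every $x$ with $\|x\|=1$, $\|T^nx\|\ge2$ or $\|T^{-n}x\|\ge2$; - uniformly positively expansive if there exists $n\in\mathbb N$ such that for every $x$ with $\|x\|=1$, $\|T^nx\|\ge2$. A limit being $\infty$ uniformly on a family $\mathcal F$ of sets means: for every $M>0$ there is $\overline n\in\mathbb N$ such that the quantity exceeds $M$ for all $n\ge\overline n$ and all $B\in\mathcal F$. *)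

theory Defs
  imports "HOL-Analysis.Analysis"
begin

section \<open>The complex Lebesgue space\<close>

definition Lp_fun :: "'a measure \<Rightarrow> real \<Rightarrow> ('a \<Rightarrow> complex) set" where
  "Lp_fun M p = {\<phi> \<in> borel_measurable M. integrable M (\<lambda>x. norm (\<phi> x) powr p)}"

definition Lp_rel :: "'a measure \<Rightarrow> real \<Rightarrow> (('a \<Rightarrow> complex) \<times> ('a \<Rightarrow> complex)) set" where
  "Lp_rel M p = {(\<phi>, \<psi>). \<phi> \<in> Lp_fun M p \<and> \<psi> \<in> Lp_fun M p \<and> (AE x in M. \<phi> x = \<psi> x)}"

definition Lp_space :: "'a measure \<Rightarrow> real \<Rightarrow> ('a \<Rightarrow> complex) set set" where
  "Lp_space M p = Lp_fun M p // Lp_rel M p"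

definition Lp_norm :: "'a measure \<Rightarrow> real \<Rightarrow> ('a \<Rightarrow> complex) set \<Rightarrow> real" where
  "Lp_norm M p u = the_elem ((\<lambda>\<phi>. (\<integral>x. norm (\<phi> x) powr p \<partial>M) powr (1 / p)) ` u)"

(* The union ranges over equal classes whenever f is nonsingular; see composition_operator_class. *)
definition composition_operator ::
    "'a measure \<Rightarrow> real \<Rightarrow> ('a \<Rightarrow> 'a) \<Rightarrow> ('a \<Rightarrow> complex) set \<Rightarrow> ('a \<Rightarrow> complex) set" where
  "composition_operator M p f u = (\<Union>\<phi>\<in>u. Lp_rel M p `` {\<phi> \<circ> f})"


section \<open>Expansivity of an operator T on a normed space with carrier V and norm N\<close>

definition zpow_on :: "'v set \<Rightarrow> ('v \<Rightarrow> 'v) \<Rightarrow> int \<Rightarrow> 'v \<Rightarrow> 'v" where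
  "zpow_on V T n = (if 0 \<le> n then T ^^ nat n else inv_into V T ^^ nat (- n))"

definition positively_expansive :: "'v set \<Rightarrow> ('v \<Rightarrow> real) \<Rightarrow> ('v \<Rightarrow> 'v) \<Rightarrow> bool" where
  "positively_expansive V N T \<longleftrightarrow>
     (\<forall>x\<in>V. N x = 1 \<longrightarrow> (\<exists>n::nat. 1 \<le> n \<and> 2 \<le> N ((T ^^ n) x)))"

definition expansive :: "'v set \<Rightarrow> ('v \<Rightarrow> real) \<Rightarrow> ('v \<Rightarrow> 'v) \<Rightarrow> bool" where
  "expansive V N T \<longleftrightarrow>
     (\<forall>x\<in>V. N x = 1 \<longrightarrow> (\<exists>n::int. 2 \<le> N (zpow_on V T n x)))"

definition uniformly_positively_expansive :: "'v set \<Rightarrow> ('v \<Rightarrow> real) \<Rightarrow> ('v \<Rightarrow> 'v) \<Rightarrow> bool" where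
  "uniformly_positively_expansive V N T \<longleftrightarrow>
     (\<exists>n::nat. 1 \<le> n \<and> (\<forall>x\<in>V. N x = 1 \<longrightarrow> 2 \<le> N ((T ^^ n) x)))"

definition uniformly_expansive :: "'v set \<Rightarrow> ('v \<Rightarrow> real) \<Rightarrow> ('v \<Rightarrow> 'v) \<Rightarrow> bool" where
  "uniformly_expansive V N T \<longleftrightarrow>
     (\<exists>n::nat. 1 \<le> n \<and> (\<forall>x\<in>V. N x = 1 \<longrightarrow>
        2 \<le> N (zpow_on V T (int n) x) \<or> 2 \<le> N (zpow_on V T (- int n) x)))"


section \<open>Composition dynamical systems\<close>

(* f is a transformation of space M; its values elsewhere are irrelevant, so preimages are
   intersected with space M. *)
locale composition_dynamical_system = sigma_finite_measure M
  for M :: "'a measure" +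
  fixes f :: "'a \<Rightarrow> 'a" and p :: real
  assumes p_ge_1: "1 \<le> p"
    and inj_on_space: "inj_on f (space M)"
    and measurable_f: "f \<in> M \<rightarrow>\<^sub>M M"
    and image_in_sets: "B \<in> sets M \<Longrightarrow> f ` B \<in> sets M"
    and preimage_bound:
      "\<exists>c::real. 0 < c \<and> (\<forall>B\<in>sets M. emeasure M (f -` B \<inter> space M) \<le> ennreal c * emeasure M B)"

locale invertible_composition_dynamical_system = composition_dynamical_system +
  assumes surj_on_space: "f ` space M = space M"
    and image_bound:
      "\<exists>c::real. 0 < c \<and> (\<forall>B\<in>sets M. emeasure M (f ` B) \<le> ennreal c * emeasure M B)"

definition sets_finite_pos :: "'a measure \<Rightarrow> 'a set set" where
  "sets_finite_pos M = {B \<in> sets M. 0 < emeasure M B \<and> emeasure M B < \<infinity>}"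

definition zpreimage :: "'a measure \<Rightarrow> ('a \<Rightarrow> 'a) \<Rightarrow> int \<Rightarrow> 'a set \<Rightarrow> 'a set" where
  "zpreimage M f n B =
     (if 0 \<le> n then (f ^^ nat n) -` B \<inter> space M else (f ^^ nat (- n)) ` B)"

definition uniformly_tends_to_infinity :: "'b set \<Rightarrow> (nat \<Rightarrow> 'b \<Rightarrow> ennreal) \<Rightarrow> bool" where
  "uniformly_tends_to_infinity F Q \<longleftrightarrow>
     (\<forall>K::real. 0 < K \<longrightarrow> (\<exists>n0\<ge>1. \<forall>n\<ge>n0. \<forall>B\<in>F. ennreal K < Q n B))"


section \<open>Well-definedness of the norm and of the composition operator\<close>

lemma equiv_Lp_rel: "equiv (Lp_fun M p) (Lp_rel M p)"
proof (rule equivI)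
  show "Lp_rel M p \<subseteq> Lp_fun M p \<times> Lp_fun M p"
    by (auto simp: Lp_rel_def)
  show "refl_on (Lp_fun M p) (Lp_rel M p)"
    by (auto simp: refl_on_def Lp_rel_def)
  show "sym (Lp_rel M p)"
    by (auto simp: sym_def Lp_rel_def eq_commute)
  show "trans (Lp_rel M p)"
  proof (rule transI)
    fix \<phi> \<psi> \<xi> assume a: "(\<phi>, \<psi>) \<in> Lp_rel M p" "(\<psi>, \<xi>) \<in> Lp_rel M p"
    then have "AE x in M. \<phi> x = \<psi> x" "AE x in M. \<psi> x = \<xi> x"
      by (auto simp: Lp_rel_def)
    then have "AE x in M. \<phi> x = \<xi> x"
      by eventually_elim simp
    with a show "(\<phi>, \<xi>) \<in> Lp_rel M p"
      by (auto simp: Lp_rel_def)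
  qed
qed

lemma Lp_norm_class:
  assumes "\<phi> \<in> Lp_fun M p"
  shows "Lp_norm M p (Lp_rel M p `` {\<phi>}) = (\<integral>x. norm (\<phi> x) powr p \<partial>M) powr (1 / p)"
proof -
  have eq: "(\<integral>x. norm (\<psi> x) powr p \<partial>M) = (\<integral>x. norm (\<phi> x) powr p \<partial>M)"
    if "(\<phi>, \<psi>) \<in> Lp_rel M p" for \<psi>
  proof (rule integral_cong_AE)
    have [measurable]: "\<phi> \<in> borel_measurable M" "\<psi> \<in> borel_measurable M"
      and ae: "AE x in M. \<phi> x = \<psi> x"
      using that by (simp_all add: Lp_rel_def Lp_fun_def)
    show "(\<lambda>x. norm (\<psi> x) powr p) \<in> borel_measurable M"
      "(\<lambda>x. norm (\<phi> x) powr p) \<in> borel_measurable M"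
      by measurable
    show "AE x in M. norm (\<psi> x) powr p = norm (\<phi> x) powr p"
      using ae by eventually_elim simp
  qed
  let ?h = "\<lambda>\<psi>. (\<integral>x. norm (\<psi> x) powr p \<partial>M) powr (1 / p)"
  have "\<phi> \<in> Lp_rel M p `` {\<phi>}"
    using assms by (auto simp: Lp_rel_def)
  moreover have "?h \<psi> = ?h \<phi>" if "\<psi> \<in> Lp_rel M p `` {\<phi>}" for \<psi>
    using that by (subst eq) auto
  ultimately have "?h ` (Lp_rel M p `` {\<phi>}) = {?h \<phi>}"
    by blast
  then show ?thesis
    by (simp add: Lp_norm_def)
qed

context composition_dynamical_system
begin

lemma distr_le_scale:
  obtains c :: real where "0 < c" "distr M M f \<le> scale_measure (ennreal c) M"
proof -
  from preimage_bound obtain c :: real where c: "0 < c"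
    "\<And>B. B \<in> sets M \<Longrightarrow> emeasure M (f -` B \<inter> space M) \<le> ennreal c * emeasure M B"
    by blast
  have "distr M M f \<le> scale_measure (ennreal c) M"
    by (subst le_measure) (auto simp: emeasure_distr measurable_f c(2))
  with c(1) that show thesis by blast
qed

lemma nn_integral_comp_le:
  obtains c :: real where "0 < c"
    "\<And>g. g \<in> borel_measurable M \<Longrightarrow> (\<integral>\<^sup>+x. g (f x) \<partial>M) \<le> ennreal c * (\<integral>\<^sup>+x. g x \<partial>M)"
proof -
  obtain c where c: "0 < c" "distr M M f \<le> scale_measure (ennreal c) M"
    by (rule distr_le_scale)
  have "(\<integral>\<^sup>+x. g (f x) \<partial>M) \<le> ennreal c * (\<integral>\<^sup>+x. g x \<partial>M)"
    if g: "g \<in> borel_measurable M" for g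
  proof -
    have "(\<integral>\<^sup>+x. g (f x) \<partial>M) = nn_integral (distr M M f) g"
      using g measurable_f by (simp add: nn_integral_distr)
    also have "\<dots> \<le> nn_integral (scale_measure (ennreal c) M) g"
      by (rule nn_integral_mono_measure) (use c in auto)
    also have "\<dots> = ennreal c * (\<integral>\<^sup>+x. g x \<partial>M)"
      using g by (simp add: nn_integral_scale_measure)
    finally show ?thesis .
  qed
  with c(1) that show thesis by blast
qed

lemma AE_comp:
  assumes "AE x in M. P x"
  shows "AE x in M. P (f x)"
proof -
  obtain c :: real where c: "0 < c"
    "\<forall>B\<in>sets M. emeasure M (f -` B \<inter> space M) \<le> ennreal c * emeasure M B"
    using preimage_bound by blast
  from assms obtain Z where Z: "Z \<in> null_sets M" "{x \<in> space M. \<not> P x} \<subseteq> Z"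
    by (auto simp: eventually_ae_filter)
  have "emeasure M (f -` Z \<inter> space M) \<le> ennreal c * emeasure M Z"
    using c Z by auto
  then have "f -` Z \<inter> space M \<in> null_sets M"
    using Z measurable_f by (auto simp: null_sets_def)
  moreover have "{x \<in> space M. \<not> P (f x)} \<subseteq> f -` Z \<inter> space M"
    using Z measurable_space[OF measurable_f] by auto
  ultimately show ?thesis
    by (rule AE_I')
qed

lemma Lp_fun_comp:
  assumes "\<phi> \<in> Lp_fun M p"
  shows "\<phi> \<circ> f \<in> Lp_fun M p"
proof -
  obtain c where c: "0 < c" "\<And>g. g \<in> borel_measurable M \<Longrightarrow>
      (\<integral>\<^sup>+x. g (f x) \<partial>M) \<le> ennreal c * (\<integral>\<^sup>+x. g x \<partial>M)"
    by (rule nn_integral_comp_le) blast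
  have m: "\<phi> \<in> borel_measurable M" and i: "integrable M (\<lambda>x. norm (\<phi> x) powr p)"
    using assms by (auto simp: Lp_fun_def)
  have m': "\<phi> \<circ> f \<in> borel_measurable M"
    using m measurable_f by (rule measurable_comp[rotated])
  have fin: "(\<integral>\<^sup>+x. ennreal (norm (\<phi> x) powr p) \<partial>M) < \<infinity>"
    using i by (simp add: integrable_iff_bounded)
  have "(\<integral>\<^sup>+x. ennreal (norm (\<phi> (f x)) powr p) \<partial>M)
      \<le> ennreal c * (\<integral>\<^sup>+x. ennreal (norm (\<phi> x) powr p) \<partial>M)"
    by (rule c(2)) (use m in measurable)
  also have "\<dots> < \<infinity>"
    using fin by (simp add: ennreal_mult_less_top)
  finally have "integrable M (\<lambda>x. norm ((\<phi> \<circ> f) x) powr p)"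
    using m' by (intro integrableI_bounded) (auto simp: comp_def)
  with m' show ?thesis
    by (simp add: Lp_fun_def)
qed

lemma composition_operator_class:
  assumes "\<phi> \<in> Lp_fun M p"
  shows "composition_operator M p f (Lp_rel M p `` {\<phi>}) = Lp_rel M p `` {\<phi> \<circ> f}"
proof -
  have eq: "Lp_rel M p `` {\<psi> \<circ> f} = Lp_rel M p `` {\<phi> \<circ> f}" if "(\<phi>, \<psi>) \<in> Lp_rel M p" for \<psi>
  proof -
    have "AE x in M. \<phi> (f x) = \<psi> (f x)"
      using that by (intro AE_comp) (auto simp: Lp_rel_def)
    then have "(\<phi> \<circ> f, \<psi> \<circ> f) \<in> Lp_rel M p"
      using that by (auto simp: Lp_rel_def Lp_fun_comp)
    then show ?thesis
      by (rule equiv_class_eq[OF equiv_Lp_rel, symmetric])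
  qed
  have "\<phi> \<in> Lp_rel M p `` {\<phi>}"
    using assms by (auto simp: Lp_rel_def)
  then have "(\<Union>\<psi>\<in>Lp_rel M p `` {\<phi>}. Lp_rel M p `` {\<psi> \<circ> f})
      = (\<Union>\<psi>\<in>Lp_rel M p `` {\<phi>}. Lp_rel M p `` {\<phi> \<circ> f})"
    by (intro SUP_cong refl eq) simp
  also have "\<dots> = Lp_rel M p `` {\<phi> \<circ> f}"
    using \<open>\<phi> \<in> Lp_rel M p `` {\<phi>}\<close> by (intro UN_constant_eq) auto
  finally show ?thesis
    unfolding composition_operator_def .
qed

lemma composition_operator_in_Lp_space:
  assumes "u \<in> Lp_space M p"
  shows "composition_operator M p f u \<in> Lp_space M p"
proof -
  from assms obtain \<phi> where "\<phi> \<in> Lp_fun M p" "u = Lp_rel M p `` {\<phi>}"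
    unfolding Lp_space_def by (rule quotientE)
  then show ?thesis
    by (simp add: Lp_space_def composition_operator_class Lp_fun_comp quotientI)
qed

lemma composition_operator_bounded:
  "\<exists>C>0. \<forall>u\<in>Lp_space M p. Lp_norm M p (composition_operator M p f u) \<le> C * Lp_norm M p u"
proof -
  obtain c where c: "0 < c" "\<And>g. g \<in> borel_measurable M \<Longrightarrow>
      (\<integral>\<^sup>+x. g (f x) \<partial>M) \<le> ennreal c * (\<integral>\<^sup>+x. g x \<partial>M)"
    by (rule nn_integral_comp_le) blast
  have "Lp_norm M p (composition_operator M p f u) \<le> c powr (1 / p) * Lp_norm M p u"
    if u_in: "u \<in> Lp_space M p" for u
  proof -
    from u_in obtain \<phi> where \<phi>: "\<phi> \<in> Lp_fun M p" "u = Lp_rel M p `` {\<phi>}"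
      unfolding Lp_space_def by (rule quotientE)
    have \<phi>f: "\<phi> \<circ> f \<in> Lp_fun M p"
      using \<phi>(1) by (rule Lp_fun_comp)
    let ?I = "\<integral>x. norm (\<phi> x) powr p \<partial>M" and ?J = "\<integral>x. norm ((\<phi> \<circ> f) x) powr p \<partial>M"
    have int: "integrable M (\<lambda>x. norm (\<phi> x) powr p)"
        "integrable M (\<lambda>x. norm ((\<phi> \<circ> f) x) powr p)"
      and m: "\<phi> \<in> borel_measurable M"
      using \<phi>(1) \<phi>f by (auto simp: Lp_fun_def)
    have nn: "0 \<le> ?I" "0 \<le> ?J"
      by (auto intro: integral_nonneg_AE)
    have "(\<integral>\<^sup>+x. ennreal (norm (\<phi> (f x)) powr p) \<partial>M)
        \<le> ennreal c * (\<integral>\<^sup>+x. ennreal (norm (\<phi> x) powr p) \<partial>M)"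
      by (rule c(2)) (use m in measurable)
    then have "ennreal ?J \<le> ennreal c * ennreal ?I"
      using int by (simp add: nn_integral_eq_integral)
    then have "?J \<le> c * ?I"
      using c(1) nn by (simp flip: ennreal_mult)
    then have "?J powr (1 / p) \<le> (c * ?I) powr (1 / p)"
      using nn p_ge_1 by (intro powr_mono2) auto
    also have "\<dots> = c powr (1 / p) * ?I powr (1 / p)"
      using c(1) nn by (simp add: powr_mult)
    finally show ?thesis
      using \<phi> \<phi>f by (simp add: composition_operator_class Lp_norm_class)
  qed
  moreover have "0 < c powr (1 / p)"
    using c(1) by simp
  ultimately show ?thesis
    by (intro exI[of _ "c powr (1 / p)"]) simp
qed

end

context invertible_composition_dynamical_system
begin

lemma inv_into_image:
  assumes "B \<in> sets M"
  shows "inv_into (space M) f -` B \<inter> space M = f ` B"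
proof -
  have sub: "B \<subseteq> space M"
    using assms by (rule sets.sets_into_space)
  show ?thesis
  proof (intro set_eqI iffI)
    fix x assume "x \<in> inv_into (space M) f -` B \<inter> space M"
    then show "x \<in> f ` B"
      using surj_on_space f_inv_into_f[of x f "space M"] by force
  next
    fix x assume "x \<in> f ` B"
    then show "x \<in> inv_into (space M) f -` B \<inter> space M"
      using sub surj_on_space inj_on_space by (auto simp: subset_iff inv_into_f_f intro: rev_image_eqI)
  qed
qed

lemma inverse_system:
  "composition_dynamical_system M (inv_into (space M) f) p"
proof unfold_locales
  let ?g = "inv_into (space M) f"
  show "1 \<le> p" by (rule p_ge_1)
  show "inj_on ?g (space M)"
    using surj_on_space by (simp add: inj_on_inv_into)
  show "?g \<in> M \<rightarrow>\<^sub>M M"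
  proof (rule measurableI)
    show "?g x \<in> space M" if "x \<in> space M" for x
      using that surj_on_space inv_into_into[of x f "space M"] by simp
    show "?g -` B \<inter> space M \<in> sets M" if "B \<in> sets M" for B
      using that by (simp add: inv_into_image image_in_sets)
  qed
  show "?g ` B \<in> sets M" if "B \<in> sets M" for B
  proof -
    have sub: "B \<subseteq> space M"
      using that by (rule sets.sets_into_space)
    have "?g ` B = f -` B \<inter> space M"
    proof (intro set_eqI iffI)
      fix x assume "x \<in> ?g ` B"
      then show "x \<in> f -` B \<inter> space M"
        using sub surj_on_space by (auto simp: f_inv_into_f inv_into_into subset_iff)
    next
      fix x assume x: "x \<in> f -` B \<inter> space M"
      then have "x = ?g (f x)"
        using inj_on_space by simp
      with x show "x \<in> ?g ` B" by blast
    qed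
    then show ?thesis
      using that measurable_f by (simp add: measurable_sets)
  qed
  show "\<exists>c::real. 0 < c \<and> (\<forall>B\<in>sets M. emeasure M (?g -` B \<inter> space M) \<le> ennreal c * emeasure M B)"
    using image_bound by (simp add: inv_into_image)
qed

(* Hence, on the carrier, negative powers in zpow_on are powers of a genuine two-sided inverse,
   namely the composition operator of the inverse map. *)
lemma composition_operator_inverse:
  assumes "u \<in> Lp_space M p"
  shows "composition_operator M p f (composition_operator M p (inv_into (space M) f) u) = u"
    and "composition_operator M p (inv_into (space M) f) (composition_operator M p f u) = u"
proof -
  interpret g: composition_dynamical_system M "inv_into (space M) f" p
    by (rule inverse_system)
  let ?g = "inv_into (space M) f"
  from assms obtain \<phi> where \<phi>: "\<phi> \<in> Lp_fun M p" "u = Lp_rel M p `` {\<phi>}"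
    unfolding Lp_space_def by (rule quotientE)
  have "AE x in M. \<phi> x = (\<phi> \<circ> ?g \<circ> f) x"
    using inj_on_space by (intro AE_I2) simp
  then have "(\<phi>, \<phi> \<circ> ?g \<circ> f) \<in> Lp_rel M p"
    using \<phi>(1) by (simp add: Lp_rel_def Lp_fun_comp g.Lp_fun_comp)
  then have "Lp_rel M p `` {\<phi> \<circ> ?g \<circ> f} = u"
    unfolding \<phi>(2) by (rule equiv_class_eq[OF equiv_Lp_rel, symmetric])
  then show "composition_operator M p f (composition_operator M p ?g u) = u"
    using \<phi> by (simp add: composition_operator_class g.composition_operator_class g.Lp_fun_comp)
  have "AE x in M. \<phi> x = (\<phi> \<circ> f \<circ> ?g) x"
    using surj_on_space by (intro AE_I2) (simp add: f_inv_into_f)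
  then have "(\<phi>, \<phi> \<circ> f \<circ> ?g) \<in> Lp_rel M p"
    using \<phi>(1) by (simp add: Lp_rel_def Lp_fun_comp g.Lp_fun_comp)
  then have "Lp_rel M p `` {\<phi> \<circ> f \<circ> ?g} = u"
    unfolding \<phi>(2) by (rule equiv_class_eq[OF equiv_Lp_rel, symmetric])
  then show "composition_operator M p ?g (composition_operator M p f u) = u"
    using \<phi> by (simp add: composition_operator_class g.composition_operator_class Lp_fun_comp)
qed

lemma bij_betw_composition_operator:
  "bij_betw (composition_operator M p f) (Lp_space M p) (Lp_space M p)"
proof -
  interpret g: composition_dynamical_system M "inv_into (space M) f" p
    by (rule inverse_system)
  show ?thesis
    by (rule bij_betwI[where g = "composition_operator M p (inv_into (space M) f)"])
      (auto simp: composition_operator_in_Lp_space g.composition_operator_in_Lp_space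
        composition_operator_inverse)
qed

end

end

theory Submission
  imports Defs
begin

text \<open>For \<open>\<phi>\<close> in \<open>L\<^sup>p\<close> the \<open>p\<close>-th power of the norm of \<open>\<phi> \<circ> f\<^sup>n\<close> is the integral of \<open>\<bar>\<phi>\<bar>\<^sup>p\<close>
  against \<open>B \<mapsto> \<mu>(f\<^sup>-\<^sup>n B)\<close>. Testing on indicators turns expansion of vectors into growth of
  \<open>\<mu>(f\<^sup>-\<^sup>n B)\<close> by the factor \<open>2\<^sup>p\<close>, which iterates. Conversely, a level set of \<open>\<bar>\<phi>\<bar>\<close> suffices for
  plain expansivity, and for the uniform notions an inequality between measures of sets integrates
  to the same inequality for \<open>\<bar>\<phi>\<bar>\<^sup>p\<close>. In the two-sided uniform case, \<open>B\<close> goes into the family in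
  whose direction it grows in a fixed time; when it grows by a factor of at least \<open>2 \<cdot> 2\<^sup>p\<close>
  in one direction, the sum over both directions does too, and this sum can be integrated.\<close>

section \<open>Integer iterates\<close>

lemma zpow_on_in:
  assumes "bij_betw T V V" "x \<in> V"
  shows "zpow_on V T n x \<in> V"
proof -
  have "(T ^^ k) x \<in> V" for k
    using bij_betw_funpow[OF assms(1), of k] assms(2) by (auto dest: bij_betwE)
  moreover have "(inv_into V T ^^ k) x \<in> V" for k
    using bij_betw_funpow[OF bij_betw_inv_into[OF assms(1)], of k] assms(2) by (auto dest: bij_betwE)
  ultimately show ?thesis by (simp add: zpow_on_def)
qed

lemma zpow_on_plus_1:
  assumes "bij_betw T V V" "x \<in> V"
  shows "zpow_on V T (n + 1) x = T (zpow_on V T n x)"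
proof (cases "0 \<le> n")
  case True
  then show ?thesis by (simp add: zpow_on_def nat_add_distrib)
next
  case False
  \<comment> \<open>For a negative exponent the outermost inverse is peeled off and \<open>T\<close>
    cancels it. At \<open>n = -1\<close> the result is the zeroth power, where both branches of
    \<open>zpow_on\<close> agree.\<close>
  then have n: "nat (- n) = Suc (nat (- (n + 1)))" by simp
  have "(inv_into V T ^^ k) x \<in> V" for k
    using bij_betw_funpow[OF bij_betw_inv_into[OF assms(1)], of k] assms(2) by (auto dest: bij_betwE)
  then have "T (zpow_on V T n x) = (inv_into V T ^^ nat (- (n + 1))) x"
    using False assms(1) by (simp add: zpow_on_def n bij_betw_inv_into_right del: minus_add_distrib)
  then show ?thesis
    using False by (auto simp: zpow_on_def)
qed

lemma zpow_on_add:
  assumes "bij_betw T V V" "x \<in> V"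
  shows "zpow_on V T (m + n) x = zpow_on V T m (zpow_on V T n x)"
proof (induction m rule: int_induct[where k = 0])
  case base
  then show ?case by (simp add: zpow_on_def)
next
  case (step1 i)
  then show ?case
    using zpow_on_plus_1[OF assms, of "i + n"]
      zpow_on_plus_1[OF assms(1) zpow_on_in[OF assms], of i n]
    by (simp add: algebra_simps)
next
  case (step2 i)
  \<comment> \<open>Descending, the identity is first obtained after one application of
    \<open>T\<close>, where the induction hypothesis applies; injectivity of \<open>T\<close> on
    \<open>V\<close> then removes that application.\<close>
  have "T (zpow_on V T (i - 1 + n) x) = T (zpow_on V T (i - 1) (zpow_on V T n x))"
    using step2 zpow_on_plus_1[OF assms, of "i - 1 + n"]
      zpow_on_plus_1[OF assms(1) zpow_on_in[OF assms], of "i - 1" n]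
    by (simp add: algebra_simps)
  then show ?case
    using assms zpow_on_in[OF assms(1)] by (auto dest!: bij_betw_imp_inj_on inj_onD)
qed


section \<open>Norms and integrals\<close>

lemma Lp_norm_nonneg: "\<phi> \<in> Lp_fun M p \<Longrightarrow> 0 \<le> Lp_norm M p (Lp_rel M p `` {\<phi>})"
  by (simp add: Lp_norm_class)

text \<open>Raising to the power \<open>p\<close> removes the root in the norm, so that norms can be
  compared inside \<open>ennreal\<close>, where integrals need no separate integrability
  conditions.\<close>

lemma nn_integral_eq_Lp_norm:
  assumes "\<phi> \<in> Lp_fun M p" "1 \<le> p"
  shows "(\<integral>\<^sup>+x. ennreal (norm (\<phi> x) powr p) \<partial>M)
    = ennreal (Lp_norm M p (Lp_rel M p `` {\<phi>}) powr p)"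
proof -
  have "(\<integral>\<^sup>+x. ennreal (norm (\<phi> x) powr p) \<partial>M) = ennreal (\<integral>x. norm (\<phi> x) powr p \<partial>M)"
    using assms by (intro nn_integral_eq_integral) (auto simp: Lp_fun_def)
  also have "(\<integral>x. norm (\<phi> x) powr p \<partial>M) = Lp_norm M p (Lp_rel M p `` {\<phi>}) powr p"
    using assms by (simp add: Lp_norm_class powr_powr integral_nonneg_AE)
  finally show ?thesis .
qed

lemma Lp_norm_ge_iff:
  assumes "\<phi> \<in> Lp_fun M p" "1 \<le> p" "0 \<le> r"
  shows "r \<le> Lp_norm M p (Lp_rel M p `` {\<phi>}) \<longleftrightarrow>
    ennreal (r powr p) \<le> (\<integral>\<^sup>+x. ennreal (norm (\<phi> x) powr p) \<partial>M)"
  using assms Lp_norm_nonneg[OF assms(1)] powr_less_mono2[of p "Lp_norm M p (Lp_rel M p `` {\<phi>})" r]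
  by (auto simp: nn_integral_eq_Lp_norm not_le[symmetric] intro: powr_mono2)

lemma Lp_norm_eq_1_iff:
  assumes "\<phi> \<in> Lp_fun M p" "1 \<le> p"
  shows "Lp_norm M p (Lp_rel M p `` {\<phi>}) = 1 \<longleftrightarrow>
    (\<integral>\<^sup>+x. ennreal (norm (\<phi> x) powr p) \<partial>M) = 1"
proof -
  let ?N = "Lp_norm M p (Lp_rel M p `` {\<phi>})"
  have "?N = 1" if "?N powr p = 1"
    using that assms(2) Lp_norm_nonneg[OF assms(1)] powr_powr[of ?N p "1 / p"] by simp
  then show ?thesis
    using assms by (auto simp: nn_integral_eq_Lp_norm)
qed

text \<open>By sigma-finiteness a set of infinite measure contains sets of arbitrarily large finite
  measure. Testing on indicators needs this, since only sets of finite measure have an indicator in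
  the L^p space.\<close>

lemma (in sigma_finite_measure) obtain_finite_pos_subset:
  assumes "B \<in> sets M" "0 < emeasure M B"
  obtains A where "A \<in> sets_finite_pos M" "A \<subseteq> B"
proof (cases "emeasure M B = \<infinity>")
  case True
  from approx_PInf_emeasure_with_finite[OF assms(1) True, of 1]
  obtain Z where "Z \<in> sets M" "Z \<subseteq> B" "emeasure M Z < \<infinity>" "1 < emeasure M Z"
    by auto
  then show ?thesis
    by (intro that[of Z]) (auto simp: sets_finite_pos_def intro: less_trans[of 0 1])
next
  case False
  then show ?thesis
    using assms by (intro that[of B]) (auto simp: sets_finite_pos_def less_top)
qed


section \<open>Iterates of a composition dynamical system\<close>

context composition_dynamical_system
begin

text \<open>The constant is raised to at least 1 so that its powers increase with the
  exponent.\<close>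

lemma obtain_preimage_bound:
  obtains c :: real where "1 \<le> c"
    "\<And>B. B \<in> sets M \<Longrightarrow> emeasure M (f -` B \<inter> space M) \<le> ennreal c * emeasure M B"
proof -
  obtain c where c: "0 < c"
    "\<forall>B\<in>sets M. emeasure M (f -` B \<inter> space M) \<le> ennreal c * emeasure M B"
    using preimage_bound by blast
  then have "emeasure M (f -` B \<inter> space M) \<le> ennreal (max 1 c) * emeasure M B" if "B \<in> sets M" for B
    using that by (intro order_trans[OF c(2)[rule_format, OF that]] mult_right_mono ennreal_leI) auto
  then show thesis
    by (intro that[of "max 1 c"]) auto
qed

lemma funpow_space: "x \<in> space M \<Longrightarrow> (f ^^ n) x \<in> space M"
  by (induction n) (auto intro: measurable_space[OF measurable_f])

lemma vimage_funpow_Suc: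
  "(f ^^ Suc n) -` B \<inter> space M = f -` ((f ^^ n) -` B \<inter> space M) \<inter> space M"
  using measurable_space[OF measurable_f] by (auto simp: funpow_Suc_right simp del: funpow.simps)

lemma funpow_measurable: "f ^^ n \<in> M \<rightarrow>\<^sub>M M"
proof (induction n)
  case (Suc n)
  then show ?case
    using measurable_comp[OF Suc measurable_f] by (simp only: funpow.simps)
qed auto

lemma preimage_power_bound:
  assumes c: "1 \<le> c"
    "\<And>B. B \<in> sets M \<Longrightarrow> emeasure M (f -` B \<inter> space M) \<le> ennreal c * emeasure M B"
    and B: "B \<in> sets M"
  shows "emeasure M ((f ^^ n) -` B \<inter> space M) \<le> ennreal (c ^ n) * emeasure M B"
proof (induction n)
  case 0
  show ?case using B by (simp add: sets.Int_space_eq2)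
next
  case (Suc n)
  have "(f ^^ n) \<in> M \<rightarrow>\<^sub>M M" by (rule funpow_measurable)
  then have "emeasure M ((f ^^ Suc n) -` B \<inter> space M)
      \<le> ennreal c * emeasure M ((f ^^ n) -` B \<inter> space M)"
    unfolding vimage_funpow_Suc using B by (intro c(2) measurable_sets)
  also have "\<dots> \<le> ennreal c * (ennreal (c ^ n) * emeasure M B)"
    by (intro mult_left_mono Suc) auto
  finally show ?case
    using c(1) by (simp add: ennreal_mult mult.assoc del: funpow.simps)
qed

text \<open>With this, whatever is proved for one map applies to each iterate, in particular the
  passage to classes in the L^p space.\<close>

lemma funpow_system: "composition_dynamical_system M (f ^^ n) p"
proof unfold_locales
  show "1 \<le> p" by (rule p_ge_1)
  show "f ^^ n \<in> M \<rightarrow>\<^sub>M M" by (rule funpow_measurable)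
  show "inj_on (f ^^ n) (space M)"
  proof (induction n)
    case (Suc n)
    have "inj_on f ((f ^^ n) ` space M)"
      using inj_on_space by (rule inj_on_subset) (auto intro: funpow_space)
    with Suc show ?case using comp_inj_on[of "f ^^ n" "space M" f] by (simp only: funpow.simps)
  qed auto
  show "(f ^^ n) ` B \<in> sets M" if "B \<in> sets M" for B
  proof (induction n)
    case (Suc n)
    then show ?case
      using image_in_sets[OF Suc] by (simp only: funpow.simps image_comp)
  qed (use that in auto)
  obtain c where "1 \<le> c"
    "\<And>B. B \<in> sets M \<Longrightarrow> emeasure M (f -` B \<inter> space M) \<le> ennreal c * emeasure M B"
    by (rule obtain_preimage_bound) blast
  then show "\<exists>c::real. 0 < c \<and>
      (\<forall>B\<in>sets M. emeasure M ((f ^^ n) -` B \<inter> space M) \<le> ennreal c * emeasure M B)"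
    using preimage_power_bound by (intro exI[of _ "c ^ n"]) auto
qed

lemma composition_operator_funpow:
  assumes "u \<in> Lp_space M p"
  shows "(composition_operator M p f ^^ n) u = composition_operator M p (f ^^ n) u"
proof -
  from assms obtain \<phi> where \<phi>: "\<phi> \<in> Lp_fun M p" "u = Lp_rel M p `` {\<phi>}"
    unfolding Lp_space_def by (rule quotientE)
  have "(composition_operator M p f ^^ n) u = Lp_rel M p `` {\<phi> \<circ> f ^^ n}"
  proof (induction n)
    case (Suc n)
    have "(composition_operator M p f ^^ Suc n) u
        = composition_operator M p f (Lp_rel M p `` {\<phi> \<circ> f ^^ n})"
      by (simp only: funpow.simps comp_apply[of "composition_operator M p f"] Suc)
    also have "\<dots> = Lp_rel M p `` {(\<phi> \<circ> f ^^ n) \<circ> f}"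
      using \<phi>(1) by (intro composition_operator_class composition_dynamical_system.Lp_fun_comp
        funpow_system)
    finally show ?case by (simp only: comp_assoc funpow_Suc_right)
  qed (use \<phi> in simp)
  with \<phi> show ?thesis
    by (simp add: composition_dynamical_system.composition_operator_class[OF funpow_system])
qed

lemma preimage_finite:
  assumes "B \<in> sets M" "emeasure M B < \<infinity>"
  shows "emeasure M (f -` B \<inter> space M) < \<infinity>"
proof -
  obtain c where "emeasure M (f -` B \<inter> space M) \<le> ennreal c * emeasure M B"
    using preimage_bound assms by blast
  also have "\<dots> < \<infinity>" using assms by (simp add: ennreal_mult_less_top)
  finally show ?thesis .
qed

text \<open>Growth is given only along multiples of \<open>n\<close>. From a time \<open>m\<close>,
  at most \<open>n\<close> further preimages lead to the next multiple \<open>n * k\<close>, and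
  these enlarge measure by at most \<open>c ^ n\<close>. Hence the measure at time \<open>m\<close>
  is at least \<open>q ^ k / c ^ n\<close> times that of \<open>B\<close>.\<close>

lemma uniformly_tends_to_infinity_preimages:
  fixes q :: real
  assumes q: "1 < q" and n: "1 \<le> n" and F: "F \<subseteq> sets_finite_pos M"
    and growth: "\<And>k B. B \<in> F \<Longrightarrow>
      ennreal (q ^ k) * emeasure M B \<le> emeasure M ((f ^^ (n * k)) -` B \<inter> space M)"
  shows "uniformly_tends_to_infinity F (\<lambda>m B. emeasure M ((f ^^ m) -` B \<inter> space M) / emeasure M B)"
  unfolding uniformly_tends_to_infinity_def
proof (intro allI impI)
  fix K :: real assume K: "0 < K"
  obtain c where c: "1 \<le> c"
    "\<And>B. B \<in> sets M \<Longrightarrow> emeasure M (f -` B \<inter> space M) \<le> ennreal c * emeasure M B"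
    by (rule obtain_preimage_bound) blast
  \<comment> \<open>The exponent \<open>k0\<close> makes the growth absorb both the target
    \<open>K\<close> and the loss \<open>c ^ n\<close>.\<close>
  obtain k0 where k0: "K * c ^ n < q ^ k0"
    using real_arch_pow[OF q] by blast
  have "ennreal K < emeasure M ((f ^^ m) -` B \<inter> space M) / emeasure M B"
    if m: "max 1 (n * k0) \<le> m" and B: "B \<in> F" for m B
  proof -
    \<comment> \<open>The successor puts \<open>n * k\<close> above \<open>m\<close>, at a distance
      of at most \<open>n\<close>.\<close>
    define k where "k = Suc (m div n)"
    have "k0 \<le> m div n"
      using m n div_le_mono[of "n * k0" m n] by simp
    then have k: "k0 \<le> k" by (simp add: k_def)
    have "n * (m div n) + m mod n = m" "m mod n < n"
      using n by auto
    moreover have "n * k = n * (m div n) + n"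
      by (simp add: k_def)
    ultimately have nk: "m \<le> n * k" "n * k - m \<le> n"
      by linarith+
    have Bs: "B \<in> sets M" and Bpos: "0 < emeasure M B" and Bfin: "emeasure M B < \<infinity>"
      using B F by (auto simp: sets_finite_pos_def)
    have Ms: "(f ^^ m) -` B \<inter> space M \<in> sets M"
      using Bs funpow_measurable by (rule measurable_sets[rotated])
    have "(f ^^ (n * k)) -` B \<inter> space M
        = (f ^^ (n * k - m)) -` ((f ^^ m) -` B \<inter> space M) \<inter> space M"
      using nk(1) funpow_add[of m "n * k - m" f] funpow_space by auto
    then have "ennreal (q ^ k) * emeasure M B
        \<le> emeasure M ((f ^^ (n * k - m)) -` ((f ^^ m) -` B \<inter> space M) \<inter> space M)"
      using growth[OF B, of k] by simp
    also have "\<dots> \<le> ennreal (c ^ (n * k - m)) * emeasure M ((f ^^ m) -` B \<inter> space M)"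
      by (intro preimage_power_bound c Ms)
    also have "\<dots> \<le> ennreal (c ^ n) * emeasure M ((f ^^ m) -` B \<inter> space M)"
      using c(1) nk(2) by (intro mult_right_mono ennreal_leI power_increasing) auto
    finally have le: "ennreal (q ^ k) * emeasure M B
      \<le> ennreal (c ^ n) * emeasure M ((f ^^ m) -` B \<inter> space M)" .
    \<comment> \<open>Finiteness of both measures allows passing to the reals, where
      \<open>c ^ n\<close> cancels and division by \<open>b\<close> is possible.\<close>
    obtain b where b: "emeasure M B = ennreal b" "0 < b"
      using Bpos Bfin by (cases "emeasure M B") (auto simp: less_top)
    have "emeasure M ((f ^^ m) -` B \<inter> space M) < \<infinity>"
      by (rule composition_dynamical_system.preimage_finite[OF funpow_system Bs Bfin])
    then obtain a where a: "emeasure M ((f ^^ m) -` B \<inter> space M) = ennreal a" "0 \<le> a"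
      by (cases "emeasure M ((f ^^ m) -` B \<inter> space M)") (auto simp: less_top)
    have "q ^ k * b \<le> c ^ n * a"
      using le a b c(1) q by (simp flip: ennreal_mult)
    moreover have "K * c ^ n * b < q ^ k * b"
      using less_le_trans[OF k0 power_increasing[OF k]] q b by (intro mult_strict_right_mono) auto
    ultimately have "c ^ n * (K * b) < c ^ n * a"
      by (simp add: mult_ac)
    then have "K * b < a"
      using c(1) by simp
    then have "K < a / b"
      using b by (simp add: pos_less_divide_eq)
    then show ?thesis
      using a b K by (simp add: divide_ennreal ennreal_lessI)
  qed
  then show "\<exists>n0\<ge>1. \<forall>m\<ge>n0. \<forall>B\<in>F. ennreal K < emeasure M ((f ^^ m) -` B \<inter> space M) / emeasure M B"
    by (intro exI[of _ "max 1 (n * k0)"]) auto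
qed

end


section \<open>Families of composition operators\<close>

text \<open>The four notions are instances of this: \<open>I\<close> is the set of positive
  naturals, the set of all integers, a single \<open>n\<close>, or the pair of \<open>n\<close> and
  \<open>- n\<close>.\<close>

definition expanding_family :: "'a measure \<Rightarrow> real \<Rightarrow> 'i set \<Rightarrow> ('i \<Rightarrow> 'a \<Rightarrow> 'a) \<Rightarrow> bool" where
  "expanding_family M p I h \<longleftrightarrow>
    (\<forall>u\<in>Lp_space M p. Lp_norm M p u = 1 \<longrightarrow>
      (\<exists>i\<in>I. 2 \<le> Lp_norm M p (composition_operator M p (h i) u)))"

locale composition_family = sigma_finite_measure M
  for M :: "'a measure" +
  fixes p :: real and I :: "'i set" and h :: "'i \<Rightarrow> 'a \<Rightarrow> 'a"
  assumes p_ge_1: "1 \<le> p"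
    and system: "i \<in> I \<Longrightarrow> composition_dynamical_system M (h i) p"
begin

lemma measurable_h [measurable]: "i \<in> I \<Longrightarrow> h i \<in> M \<rightarrow>\<^sub>M M"
  by (rule composition_dynamical_system.measurable_f[OF system])

lemma expanding_family_iff:
  "expanding_family M p I h \<longleftrightarrow>
    (\<forall>\<phi>\<in>Lp_fun M p. (\<integral>\<^sup>+x. ennreal (norm (\<phi> x) powr p) \<partial>M) = 1 \<longrightarrow>
      (\<exists>i\<in>I. ennreal (2 powr p) \<le> (\<integral>\<^sup>+x. ennreal (norm (\<phi> (h i x)) powr p) \<partial>M)))"
proof -
  have "2 \<le> Lp_norm M p (composition_operator M p (h i) (Lp_rel M p `` {\<phi>})) \<longleftrightarrow>
      ennreal (2 powr p) \<le> (\<integral>\<^sup>+x. ennreal (norm (\<phi> (h i x)) powr p) \<partial>M)"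
    if "\<phi> \<in> Lp_fun M p" "i \<in> I" for \<phi> i
    using that Lp_norm_ge_iff[of "\<phi> \<circ> h i" M p 2] p_ge_1
    by (simp add: composition_dynamical_system.composition_operator_class[OF system]
        composition_dynamical_system.Lp_fun_comp[OF system])
  moreover have "(\<forall>u\<in>Lp_space M p. P u) \<longleftrightarrow> (\<forall>\<phi>\<in>Lp_fun M p. P (Lp_rel M p `` {\<phi>}))" for P
    by (auto simp: Lp_space_def intro: quotientI elim!: quotientE)
  ultimately show ?thesis
    by (simp add: expanding_family_def Lp_norm_eq_1_iff p_ge_1)
qed

text \<open>The test vector is the indicator of \<open>A\<close> scaled to norm 1: the
  \<open>p\<close>-th power of its modulus is \<open>1 / a\<close> on \<open>A\<close>, so composing
  with \<open>h i\<close> turns the norm condition into a ratio of measures.\<close>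

lemma expanding_familyD:
  assumes "expanding_family M p I h" and A: "A \<in> sets_finite_pos M"
  obtains i where "i \<in> I" "ennreal (2 powr p) * emeasure M A \<le> emeasure M (h i -` A \<inter> space M)"
proof -
  have As [measurable]: "A \<in> sets M"
    using A by (simp add: sets_finite_pos_def)
  obtain a where a: "emeasure M A = ennreal a" "0 < a"
    using A by (cases "emeasure M A") (auto simp: sets_finite_pos_def less_top)
  define \<phi> :: "'a \<Rightarrow> complex" where "\<phi> x = of_real (indicator A x * a powr (- 1 / p))" for x
  have \<phi>: "norm (\<phi> x) powr p = indicator A x * (1 / a)" for x
    using a p_ge_1 by (auto simp: \<phi>_def indicator_def norm_mult powr_powr powr_minus_divide norm_divide powr_divide)
  have [measurable]: "\<phi> \<in> borel_measurable M"
    unfolding \<phi>_def by measurable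
  have "integrable M (\<lambda>x. norm (\<phi> x) powr p)"
    unfolding \<phi> using a by (intro integrable_mult_left integrable_real_indicator) auto
  then have Lp: "\<phi> \<in> Lp_fun M p"
    by (simp add: Lp_fun_def)
  \<comment> \<open>A general \<open>g\<close> covers both the identity, for the norm of
    \<open>\<phi>\<close> itself, and the maps \<open>h i\<close>.\<close>
  have norm: "(\<integral>\<^sup>+x. ennreal (norm (\<phi> (g x)) powr p) \<partial>M)
      = emeasure M (g -` A \<inter> space M) * ennreal (1 / a)" if [measurable]: "g \<in> M \<rightarrow>\<^sub>M M" for g
  proof -
    have "(\<integral>\<^sup>+x. ennreal (norm (\<phi> (g x)) powr p) \<partial>M)
        = (\<integral>\<^sup>+x. indicator (g -` A \<inter> space M) x * ennreal (1 / a) \<partial>M)"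
      unfolding \<phi> by (intro nn_integral_cong) (auto simp: indicator_def)
    also have "\<dots> = emeasure M (g -` A \<inter> space M) * ennreal (1 / a)"
      by (subst nn_integral_multc) auto
    finally show ?thesis .
  qed
  have "(\<integral>\<^sup>+x. ennreal (norm (\<phi> x) powr p) \<partial>M) = 1"
    using norm[of "\<lambda>x. x"] a by (simp add: sets.Int_space_eq2 flip: ennreal_mult)
  with assms(1) Lp obtain i where i: "i \<in> I"
    "ennreal (2 powr p) \<le> (\<integral>\<^sup>+x. ennreal (norm (\<phi> (h i x)) powr p) \<partial>M)"
    unfolding expanding_family_iff by blast
  have "ennreal (2 powr p) * emeasure M A
      \<le> emeasure M (h i -` A \<inter> space M) * ennreal (1 / a) * emeasure M A"
    using i by (intro mult_right_mono) (auto simp: norm)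
  also have "\<dots> = emeasure M (h i -` A \<inter> space M)"
    using a by (simp add: mult.assoc flip: ennreal_mult)
  finally show ?thesis
    using i(1) that by blast
qed

text \<open>A unit vector is not almost everywhere zero, so some level set has positive measure.
  Since its preimages have unbounded measure, the part of the integral over one of them alone is
  large enough.\<close>

lemma expanding_familyI_SUP:
  assumes unbdd: "\<And>B. B \<in> sets M \<Longrightarrow> 0 < emeasure M B \<Longrightarrow>
    (SUP i\<in>I. emeasure M (h i -` B \<inter> space M)) = \<infinity>"
  shows "expanding_family M p I h"
  unfolding expanding_family_iff
proof (intro ballI impI)
  fix \<phi> assume "\<phi> \<in> Lp_fun M p" and one: "(\<integral>\<^sup>+x. ennreal (norm (\<phi> x) powr p) \<partial>M) = 1"
  then have [measurable]: "\<phi> \<in> borel_measurable M"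
    by (simp add: Lp_fun_def)
  define B where "B k = {x \<in> space M. 1 / real (Suc k) \<le> norm (\<phi> x) powr p}" for k
  have [measurable]: "B k \<in> sets M" for k
    unfolding B_def by measurable
  have "\<exists>k. emeasure M (B k) \<noteq> 0"
  proof (rule ccontr)
    assume "\<not> ?thesis"
    then have "(\<Union>k. B k) \<in> null_sets M"
      by (intro null_sets_UN) (auto simp: null_sets_def)
    moreover have "{x \<in> space M. \<not> ennreal (norm (\<phi> x) powr p) = 0} \<subseteq> (\<Union>k. B k)"
    proof
      fix x assume "x \<in> {x \<in> space M. \<not> ennreal (norm (\<phi> x) powr p) = 0}"
      then have x: "x \<in> space M" "0 < norm (\<phi> x) powr p"
        by (auto simp: less_le)
      obtain k where "1 / real (Suc k) < norm (\<phi> x) powr p"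
        using nat_approx_posE[OF x(2)] by blast
      with x show "x \<in> (\<Union>k. B k)"
        by (auto simp: B_def intro!: exI[of _ k])
    qed
    ultimately have "AE x in M. ennreal (norm (\<phi> x) powr p) = 0"
      by (rule AE_I')
    then have "(\<integral>\<^sup>+x. ennreal (norm (\<phi> x) powr p) \<partial>M) = 0"
      by (subst nn_integral_0_iff_AE) auto
    with one show False by simp
  qed
  then obtain k where "0 < emeasure M (B k)"
    by (auto simp: zero_less_iff_neq_zero)
  then have "(SUP i\<in>I. emeasure M (h i -` B k \<inter> space M)) = \<infinity>"
    by (intro unbdd) auto
  \<comment> \<open>The bound is chosen so that \<open>2 powr p\<close> remains after multiplying by
    \<open>1 / real (Suc k)\<close>, the lower bound that defines the level set.\<close>
  then have "ennreal (real (Suc k) * 2 powr p) < (SUP i\<in>I. emeasure M (h i -` B k \<inter> space M))"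
    by (simp only: infinity_ennreal_def ennreal_less_top)
  then obtain i where i: "i \<in> I"
    "ennreal (real (Suc k) * 2 powr p) < emeasure M (h i -` B k \<inter> space M)"
    by (auto simp: less_SUP_iff)
  note [measurable] = measurable_h[OF i(1)]
  have "ennreal (2 powr p) = ennreal (1 / real (Suc k)) * ennreal (real (Suc k) * 2 powr p)"
    by (simp flip: ennreal_mult del: of_nat_Suc)
  also have "\<dots> \<le> ennreal (1 / real (Suc k)) * emeasure M (h i -` B k \<inter> space M)"
    using i(2) by (intro mult_left_mono) auto
  also have "\<dots> = (\<integral>\<^sup>+x. ennreal (1 / real (Suc k)) * indicator (h i -` B k \<inter> space M) x \<partial>M)"
    by (subst nn_integral_cmult) auto
  also have "\<dots> \<le> (\<integral>\<^sup>+x. ennreal (norm (\<phi> (h i x)) powr p) \<partial>M)"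
    by (intro nn_integral_mono) (auto simp: indicator_def B_def intro!: ennreal_leI)
  finally show "\<exists>i\<in>I. ennreal (2 powr p) \<le> (\<integral>\<^sup>+x. ennreal (norm (\<phi> (h i x)) powr p) \<partial>M)"
    using i(1) by blast
qed

text \<open>Expansion is only by the factor 2, but it can be applied again to the preimage just obtained.\<close>

lemma expanding_family_SUP:
  assumes exp: "expanding_family M p I h"
    and closed: "\<And>i j. i \<in> I \<Longrightarrow> j \<in> I \<Longrightarrow> \<exists>k\<in>I. \<forall>x\<in>space M. h k x = h i (h j x)"
    and B: "B \<in> sets M" "0 < emeasure M B"
  shows "(SUP i\<in>I. emeasure M (h i -` B \<inter> space M)) = \<infinity>"
proof -
  \<comment> \<open>Finite measure is needed to test the expansion on \<open>A\<close>, and it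
    persists for preimages; monotonicity returns to \<open>B\<close> at the end.\<close>
  obtain A where A: "A \<in> sets_finite_pos M" "A \<subseteq> B"
    using obtain_finite_pos_subset[OF B] .
  then have As: "A \<in> sets M" "0 < emeasure M A" "emeasure M A < \<infinity>"
    by (auto simp: sets_finite_pos_def)
  have ge_2: "2 * a \<le> ennreal (2 powr p) * a" for a :: ennreal
    using p_ge_1 powr_mono[of 1 p 2] by (intro mult_right_mono) (auto simp flip: ennreal_numeral)
  \<comment> \<open>The base case is already one application of the expansion, so the identity need
    not be in the family.\<close>
  have step: "\<exists>i\<in>I. 2 ^ Suc k * emeasure M A \<le> emeasure M (h i -` A \<inter> space M)" for k
  proof (induction k)
    case 0
    obtain i where "i \<in> I" "ennreal (2 powr p) * emeasure M A \<le> emeasure M (h i -` A \<inter> space M)"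
      by (rule expanding_familyD[OF exp A(1)])
    then show ?case
      using order_trans[OF ge_2[of "emeasure M A"]] by auto
  next
    case (Suc k)
    then obtain i where i: "i \<in> I" "2 ^ Suc k * emeasure M A \<le> emeasure M (h i -` A \<inter> space M)"
      by blast
    let ?C = "h i -` A \<inter> space M"
    have "0 < 2 ^ Suc k * emeasure M A"
      using As by (simp add: zero_less_iff_neq_zero del: power_Suc)
    then have "0 < emeasure M ?C"
      using i(2) by (rule less_le_trans)
    then have "?C \<in> sets_finite_pos M"
      using As i(1) composition_dynamical_system.preimage_finite[OF system[OF i(1)] As(1,3)]
      by (auto simp: sets_finite_pos_def intro: measurable_sets measurable_h)
    then obtain j where j: "j \<in> I"
      "ennreal (2 powr p) * emeasure M ?C \<le> emeasure M (h j -` ?C \<inter> space M)"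
      by (rule expanding_familyD[OF exp])
    \<comment> \<open>Closure under composition merges the two successive preimages into one
      preimage under a single member of the family.\<close>
    obtain l where l: "l \<in> I" "\<forall>x\<in>space M. h l x = h i (h j x)"
      using closed[OF i(1) j(1)] by blast
    have "2 ^ Suc (Suc k) * emeasure M A \<le> 2 * emeasure M ?C"
      using mult_left_mono[OF i(2), of 2] by (simp add: mult.assoc)
    also have "\<dots> \<le> ennreal (2 powr p) * emeasure M ?C"
      by (rule ge_2)
    also note j(2)
    also have "h j -` ?C \<inter> space M = h l -` A \<inter> space M"
      using l(2) measurable_space[OF measurable_h[OF j(1)]] by auto
    finally show ?case using l(1) by blast
  qed
  obtain a where a: "emeasure M A = ennreal a" "0 < a"
    using As by (cases "emeasure M A") (auto simp: less_top)
  have "ennreal r \<le> (SUP i\<in>I. emeasure M (h i -` B \<inter> space M))" for r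
  proof -
    obtain k where "r / a < 2 ^ k"
      using real_arch_pow[of 2 "r / a"] by auto
    then have "r / a < 2 ^ Suc k"
      by (rule less_trans) simp
    then have "r < 2 ^ Suc k * a"
      using a by (simp add: pos_divide_less_eq)
    then have "ennreal r \<le> ennreal (2 ^ Suc k * a)"
      by (intro ennreal_leI) simp
    also have "\<dots> = 2 ^ Suc k * emeasure M A"
      using a by (simp add: ennreal_mult flip: ennreal_numeral ennreal_power)
    also obtain i where i: "i \<in> I" "2 ^ Suc k * emeasure M A \<le> emeasure M (h i -` A \<inter> space M)"
      using step by blast
    note i(2)
    also have "emeasure M (h i -` A \<inter> space M) \<le> emeasure M (h i -` B \<inter> space M)"
      using A(2) B(1) i(1) by (intro emeasure_mono measurable_sets[OF measurable_h]) auto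
    also have "\<dots> \<le> (SUP i\<in>I. emeasure M (h i -` B \<inter> space M))"
      using i(1) by (rule SUP_upper)
    finally show ?thesis .
  qed
  then show ?thesis
    by (metis ennreal_Ex_less_of_nat ennreal_of_nat_eq_real_of_nat infinity_ennreal_def leD top.not_eq_extremum)
qed

text \<open>The inequality extends from sets to nonnegative functions by linearity and monotone
  limits. The sum over \<open>I\<close> keeps both sides additive even when different sets expand
  under different indices.\<close>

lemma nn_integral_sum_ge:
  fixes K :: ennreal
  assumes ge: "\<And>A. A \<in> sets_finite_pos M \<Longrightarrow>
      K * emeasure M A \<le> (\<Sum>i\<in>I. emeasure M (h i -` A \<inter> space M))"
    and g: "g \<in> borel_measurable M"
  shows "K * (\<integral>\<^sup>+x. g x \<partial>M) \<le> (\<Sum>i\<in>I. \<integral>\<^sup>+x. g (h i x) \<partial>M)"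
  using g
proof (induction rule: borel_measurable_induct)
  case (cong f g)
  have "(\<integral>\<^sup>+x. f x \<partial>M) = (\<integral>\<^sup>+x. g x \<partial>M)"
    using cong by (intro nn_integral_cong) auto
  moreover have "(\<Sum>i\<in>I. \<integral>\<^sup>+x. f (h i x) \<partial>M) = (\<Sum>i\<in>I. \<integral>\<^sup>+x. g (h i x) \<partial>M)"
    using cong by (intro sum.cong refl nn_integral_cong) (auto dest: measurable_space[OF measurable_h])
  ultimately show ?case using cong by simp
next
  case (set B)
  \<comment> \<open>The hypothesis covers finite positive measure, and null sets are trivial. The
    right side is stated for \<open>B\<close>, so that it stays fixed in the supremum over
    subsets.\<close>
  have fin: "K * emeasure M A \<le> (\<Sum>i\<in>I. emeasure M (h i -` B \<inter> space M))"
    if A: "A \<in> sets M" "A \<subseteq> B" "emeasure M A < \<infinity>" for A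
  proof (cases "emeasure M A = 0")
    case False
    then have "K * emeasure M A \<le> (\<Sum>i\<in>I. emeasure M (h i -` A \<inter> space M))"
      using A by (intro ge) (auto simp: sets_finite_pos_def zero_less_iff_neq_zero)
    also have "\<dots> \<le> (\<Sum>i\<in>I. emeasure M (h i -` B \<inter> space M))"
      using A set by (intro sum_mono emeasure_mono measurable_sets[OF measurable_h]) auto
    finally show ?thesis .
  qed simp
  have "K * emeasure M B \<le> (\<Sum>i\<in>I. emeasure M (h i -` B \<inter> space M))"
  proof (cases "emeasure M B = \<infinity>")
    case True
    \<comment> \<open>A set of infinite measure is exhausted by pieces of finite measure.\<close>
    obtain A where A: "range A \<subseteq> sets M" "(\<Union>k. A k) = space M"
      "\<And>k. emeasure M (A k) \<noteq> \<infinity>" "incseq A"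
      using sigma_finite_incseq by blast
    have "emeasure M B = emeasure M (\<Union>k. A k \<inter> B)"
      using A(2) set sets.sets_into_space by (metis Int_UN_distrib2 Int_absorb1 UN_simps(4))
    also have "\<dots> = (SUP k. emeasure M (A k \<inter> B))"
      using A set by (intro SUP_emeasure_incseq[symmetric]) (auto simp: incseq_def subset_iff)
    finally have "K * emeasure M B = (SUP k. K * emeasure M (A k \<inter> B))"
      by (simp add: SUP_mult_left_ennreal)
    also have "\<dots> \<le> (\<Sum>i\<in>I. emeasure M (h i -` B \<inter> space M))"
    proof (intro SUP_least fin)
      fix k
      show "A k \<inter> B \<in> sets M" using A set by auto
      have "emeasure M (A k \<inter> B) \<le> emeasure M (A k)"
        using A by (intro emeasure_mono) auto
      then show "emeasure M (A k \<inter> B) < \<infinity>"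
        using A(3)[of k] by (auto simp: less_top top_unique)
    qed auto
    finally show ?thesis .
  next
    case False
    then show ?thesis
      using set by (intro fin) (auto simp: less_top)
  qed
  moreover have "(\<integral>\<^sup>+x. indicator B (h i x) \<partial>M) = emeasure M (h i -` B \<inter> space M)" if "i \<in> I" for i
  proof -
    have "(\<integral>\<^sup>+x. indicator B (h i x) \<partial>M) = (\<integral>\<^sup>+x. indicator (h i -` B \<inter> space M) x \<partial>M)"
      by (intro nn_integral_cong) (auto simp: indicator_def)
    also have "\<dots> = emeasure M (h i -` B \<inter> space M)"
      using that set by (intro nn_integral_indicator measurable_sets[OF measurable_h]) auto
    finally show ?thesis .
  qed
  ultimately show ?case
    using set by simp
next
  case (mult u c)
  have "K * (\<integral>\<^sup>+x. c * u x \<partial>M) = c * (K * (\<integral>\<^sup>+x. u x \<partial>M))"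
    using mult by (simp add: nn_integral_cmult mult_ac)
  also have "\<dots> \<le> c * (\<Sum>i\<in>I. \<integral>\<^sup>+x. u (h i x) \<partial>M)"
    using mult by (intro mult_left_mono) auto
  also have "\<dots> = (\<Sum>i\<in>I. \<integral>\<^sup>+x. c * u (h i x) \<partial>M)"
    unfolding sum_distrib_left using mult
    by (intro sum.cong refl nn_integral_cmult[symmetric]) (auto intro: measurable_compose measurable_h)
  finally show ?case .
next
  case (add u v)
  have "(\<Sum>i\<in>I. \<integral>\<^sup>+x. v (h i x) + u (h i x) \<partial>M)
      = (\<Sum>i\<in>I. (\<integral>\<^sup>+x. v (h i x) \<partial>M) + (\<integral>\<^sup>+x. u (h i x) \<partial>M))"
    using add by (intro sum.cong refl nn_integral_add) (auto intro: measurable_compose measurable_h)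
  then show ?case
    using add by (simp add: nn_integral_add distrib_left sum.distrib add_mono)
next
  case (seq U)
  \<comment> \<open>A bound for each \<open>U j\<close> suffices, since the integrals on the left
    increase to that of the supremum.\<close>
  have "K * (\<integral>\<^sup>+x. U j x \<partial>M) \<le> (\<Sum>i\<in>I. \<integral>\<^sup>+x. (SUP j. U j) (h i x) \<partial>M)" for j
  proof -
    have "K * (\<integral>\<^sup>+x. U j x \<partial>M) \<le> (\<Sum>i\<in>I. \<integral>\<^sup>+x. U j (h i x) \<partial>M)"
      by (rule seq)
    also have "\<dots> \<le> (\<Sum>i\<in>I. \<integral>\<^sup>+x. (SUP j. U j) (h i x) \<partial>M)"
      by (intro sum_mono nn_integral_mono) (auto simp: SUP_apply intro: SUP_upper)
    finally show ?thesis .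
  qed
  moreover have "(\<integral>\<^sup>+x. (SUP j. U j) x \<partial>M) = (SUP j. \<integral>\<^sup>+x. U j x \<partial>M)"
    using seq by (simp add: image_image nn_integral_monotone_convergence_SUP)
  ultimately show ?case
    by (simp add: SUP_mult_left_ennreal SUP_le_iff)
qed

text \<open>Among \<open>card I\<close> terms whose sum is at least \<open>card I\<close> times
  \<open>2 powr p\<close>, one reaches \<open>2 powr p\<close>. The integrated inequality supplies
  such a sum for each unit vector; the index found may depend on the vector.\<close>

lemma expanding_familyI_sum:
  assumes "finite I" "I \<noteq> {}"
    and ge: "\<And>A. A \<in> sets_finite_pos M \<Longrightarrow> ennreal (real (card I) * 2 powr p) * emeasure M A
        \<le> (\<Sum>i\<in>I. emeasure M (h i -` A \<inter> space M))"
  shows "expanding_family M p I h"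
  unfolding expanding_family_iff
proof (intro ballI impI)
  fix \<phi> assume "\<phi> \<in> Lp_fun M p" and one: "(\<integral>\<^sup>+x. ennreal (norm (\<phi> x) powr p) \<partial>M) = 1"
  then have [measurable]: "\<phi> \<in> borel_measurable M"
    by (simp add: Lp_fun_def)
  have ge': "ennreal (real (card I) * 2 powr p) * (\<integral>\<^sup>+x. ennreal (norm (\<phi> x) powr p) \<partial>M)
      \<le> (\<Sum>i\<in>I. \<integral>\<^sup>+x. ennreal (norm (\<phi> (h i x)) powr p) \<partial>M)"
    by (rule nn_integral_sum_ge[OF ge]) auto
  define a where "a i = (\<integral>\<^sup>+x. ennreal (norm (\<phi> (h i x)) powr p) \<partial>M)" for i
  show "\<exists>i\<in>I. ennreal (2 powr p) \<le> (\<integral>\<^sup>+x. ennreal (norm (\<phi> (h i x)) powr p) \<partial>M)"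
  proof (rule ccontr)
    assume "\<not> ?thesis"
    then have lt: "a i < ennreal (2 powr p)" if "i \<in> I" for i
      using that by (auto simp: a_def not_le)
    \<comment> \<open>Passing through the maximum keeps the inequality strict: it is one of finitely
      many values below \<open>2 powr p\<close>.\<close>
    have "(\<Sum>i\<in>I. a i) \<le> of_nat (card I) * Max (a ` I)"
      using assms(1) by (intro sum_bounded_above Max_ge) auto
    also have "\<dots> < of_nat (card I) * ennreal (2 powr p)"
      using assms(1,2) lt by (intro ennreal_mult_strict_left_mono) (auto simp: card_gt_0_iff of_nat_less_top)
    also have "\<dots> = ennreal (real (card I) * 2 powr p)"
      by (simp add: ennreal_mult ennreal_of_nat_eq_real_of_nat)
    finally show False
      using ge' one by (simp add: a_def)
  qed
qed

end

section \<open>Growth ratios and the direction of growth\<close>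

lemma uniformly_tends_to_infinity_cong:
  assumes "\<And>n B. B \<in> F \<Longrightarrow> Q n B = Q' n B"
  shows "uniformly_tends_to_infinity F Q \<longleftrightarrow> uniformly_tends_to_infinity F Q'"
  using assms by (simp add: uniformly_tends_to_infinity_def)

lemma ratio_ge_imp_le:
  fixes K :: real
  assumes "ennreal K < a / b" "0 < b" "b < \<infinity>"
  shows "ennreal K * b \<le> (a :: ennreal)"
proof -
  have "ennreal K * b \<le> a / b * b"
    using assms by (intro mult_right_mono) auto
  also have "\<dots> = a"
    using assms by (simp add: ennreal_divide_times mult_divide_eq_ennreal)
  finally show ?thesis .
qed

text \<open>If \<open>A\<close> grows under \<open>F\<close>, its preimage cannot grow under \<open>G\<close>, because that leads back to \<open>A\<close>.
  So the direction in which a set grows never changes along its orbit.\<close>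

lemma geometric_growth:
  fixes q :: real
  assumes "composition_dynamical_system M F p"
    and FG: "\<And>x. x \<in> space M \<Longrightarrow> F (G x) = x" "G \<in> M \<rightarrow>\<^sub>M M"
    and q: "1 < q"
    and alt: "\<And>A. A \<in> sets_finite_pos M \<Longrightarrow>
      ennreal q * emeasure M A \<le> emeasure M (F -` A \<inter> space M) \<or>
      ennreal q * emeasure M A \<le> emeasure M (G -` A \<inter> space M)"
    and B: "B \<in> sets_finite_pos M" "ennreal q * emeasure M B \<le> emeasure M (F -` B \<inter> space M)"
  shows "ennreal (q ^ k) * emeasure M B \<le> emeasure M ((F ^^ k) -` B \<inter> space M)"
proof -
  interpret F: composition_dynamical_system M F p by fact
  define A where "A k = (F ^^ k) -` B \<inter> space M" for k
  have A_Suc: "A (Suc k) = F -` A k \<inter> space M" for k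
    unfolding A_def by (rule F.vimage_funpow_Suc)
  have Bs: "B \<in> sets M" using B by (simp add: sets_finite_pos_def)
  have A_0: "A 0 = B"
    using Bs by (simp add: A_def sets.Int_space_eq2)
  have As: "A k \<in> sets M" for k
    unfolding A_def using Bs F.funpow_measurable by (rule measurable_sets[rotated])
  \<comment> \<open>Membership in \<open>sets_finite_pos M\<close> is carried along because
    \<open>alt\<close> speaks only of such sets.\<close>
  have "A k \<in> sets_finite_pos M \<and> ennreal q * emeasure M (A k) \<le> emeasure M (A (Suc k))" for k
  proof (induction k)
    case 0
    with B show ?case by (simp add: A_Suc A_0)
  next
    case (Suc k)
    then have k: "0 < emeasure M (A k)" "emeasure M (A k) < \<infinity>"
      by (auto simp: sets_finite_pos_def)
    have fin: "emeasure M (A (Suc k)) < \<infinity>"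
      unfolding A_Suc using As k(2) by (rule F.preimage_finite)
    have "0 < ennreal q * emeasure M (A k)"
      using q k by (simp add: ennreal_zero_less_mult_iff)
    then have pos: "0 < emeasure M (A (Suc k))"
      using Suc by (auto intro: less_le_trans)
    with fin have fp: "A (Suc k) \<in> sets_finite_pos M"
      using As by (simp add: sets_finite_pos_def)
    have "\<not> ennreal q * emeasure M (A (Suc k)) \<le> emeasure M (G -` A (Suc k) \<inter> space M)"
    proof
      assume le: "ennreal q * emeasure M (A (Suc k)) \<le> emeasure M (G -` A (Suc k) \<inter> space M)"
      have "G -` A (Suc k) \<inter> space M = A k"
        using FG measurable_space[OF FG(2)] sets.sets_into_space[OF As[of k]] by (auto simp: A_Suc)
      with le have le: "ennreal q * emeasure M (A (Suc k)) \<le> emeasure M (A k)"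
        by simp
      \<comment> \<open>Both inequalities could hold together if the measures were 0 or infinite;
        finite positive values exclude this.\<close>
      obtain a b where ab: "emeasure M (A k) = ennreal a" "0 < a" "emeasure M (A (Suc k)) = ennreal b" "0 < b"
        using k pos fin by (cases "emeasure M (A k)"; cases "emeasure M (A (Suc k))") (auto simp: less_top)
      have "q * a \<le> b" "q * b \<le> a"
        using le Suc ab q by (auto simp flip: ennreal_mult)
      moreover have "a < q * a" "b < q * b"
        using q ab by auto
      ultimately show False by simp
    qed
    with alt[OF fp] fp show ?case
      by (auto simp: A_Suc)
  qed
  then have grow: "ennreal q * emeasure M (A k) \<le> emeasure M (A (Suc k))" for k
    by blast
  have "ennreal (q ^ k) * emeasure M B \<le> emeasure M (A k)"
  proof (induction k)
    case 0
    show ?case by (simp add: A_0)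
  next
    case (Suc k)
    have "ennreal (q ^ Suc k) * emeasure M B = ennreal q * (ennreal (q ^ k) * emeasure M B)"
      using q by (simp add: ennreal_mult mult.assoc)
    also have "\<dots> \<le> ennreal q * emeasure M (A k)"
      by (intro mult_left_mono Suc) auto
    also note grow
    finally show ?case .
  qed
  then show ?thesis by (simp add: A_def)
qed


section \<open>Positive expansivity\<close>

context composition_dynamical_system
begin

lemma composition_family_funpow: "composition_family M p I (\<lambda>n. f ^^ n)"
  by (intro composition_family.intro composition_family_axioms.intro
      sigma_finite_measure_axioms p_ge_1 funpow_system)

text \<open>The positive iterates are closed under composition, which is what allows the expansion
  to be repeated.\<close>

lemma positively_expansive_iff_SUP:
  "positively_expansive (Lp_space M p) (Lp_norm M p) (composition_operator M p f) \<longleftrightarrow>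
    (\<forall>B\<in>sets M. 0 < emeasure M B \<longrightarrow>
      (SUP n\<in>{1::nat..}. emeasure M ((f ^^ n) -` B \<inter> space M)) = \<infinity>)"
proof -
  interpret composition_family M p "{1::nat..}" "\<lambda>n. f ^^ n"
    by (rule composition_family_funpow)
  have "positively_expansive (Lp_space M p) (Lp_norm M p) (composition_operator M p f) \<longleftrightarrow>
      expanding_family M p {1::nat..} (\<lambda>n. f ^^ n)"
    by (auto simp: positively_expansive_def expanding_family_def composition_operator_funpow)
  moreover have "\<exists>k\<in>{1..}. \<forall>x\<in>space M. (f ^^ k) x = (f ^^ i) ((f ^^ j) x)"
    if "i \<in> {1..}" "j \<in> {1..}" for i j
    using that by (intro bexI[of _ "i + j"]) (auto simp: funpow_add)
  ultimately show ?thesis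
    using expanding_family_SUP expanding_familyI_SUP by blast
qed

lemma uniformly_positively_expansive_iff:
  "uniformly_positively_expansive (Lp_space M p) (Lp_norm M p) (composition_operator M p f) \<longleftrightarrow>
    uniformly_tends_to_infinity (sets_finite_pos M)
      (\<lambda>n B. emeasure M ((f ^^ n) -` B \<inter> space M) / emeasure M B)"
    (is "?L \<longleftrightarrow> ?R")
proof
  have q: "1 < 2 powr p"
    using p_ge_1 powr_mono[of 1 p 2] by simp
  assume ?L
  then obtain n :: nat where n: "1 \<le> n" "expanding_family M p {n} (\<lambda>n. f ^^ n)"
    by (auto simp: uniformly_positively_expansive_def expanding_family_def composition_operator_funpow)
  interpret composition_family M p "{n}" "\<lambda>n. f ^^ n"
    by (rule composition_family_funpow)
  have ge: "ennreal (2 powr p) * emeasure M A \<le> emeasure M ((f ^^ n) -` A \<inter> space M)"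
    if "A \<in> sets_finite_pos M" for A
    using expanding_familyD[OF n(2) that] by auto
  interpret F: composition_dynamical_system M "f ^^ n" p by (rule funpow_system)
  \<comment> \<open>Each preimage is again of finite positive measure, so the one-step estimate
    \<open>ge\<close> can be applied to it.\<close>
  have growth: "(f ^^ (n * k)) -` B \<inter> space M \<in> sets_finite_pos M \<and>
      ennreal ((2 powr p) ^ k) * emeasure M B \<le> emeasure M ((f ^^ (n * k)) -` B \<inter> space M)"
    if B: "B \<in> sets_finite_pos M" for B k
  proof (induction k)
    case 0
    show ?case using B by (simp add: sets_finite_pos_def sets.Int_space_eq2)
  next
    case (Suc k)
    let ?A = "(f ^^ (n * k)) -` B \<inter> space M"
    have eq: "(f ^^ (n * Suc k)) -` B \<inter> space M = (f ^^ n) -` ?A \<inter> space M"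
      using F.vimage_funpow_Suc[of k B] by (simp add: funpow_mult mult.commute del: funpow.simps)
    have A: "?A \<in> sets M" "0 < emeasure M ?A" "emeasure M ?A < \<infinity>"
      using Suc by (auto simp: sets_finite_pos_def)
    have ge': "ennreal (2 powr p) * emeasure M ?A \<le> emeasure M ((f ^^ n) -` ?A \<inter> space M)"
      using Suc ge by blast
    have "0 < ennreal (2 powr p) * emeasure M ?A"
      using A by (simp add: ennreal_zero_less_mult_iff)
    then have "(f ^^ n) -` ?A \<inter> space M \<in> sets_finite_pos M"
      using A ge' F.preimage_finite[OF A(1,3)] measurable_sets[OF F.measurable_f A(1)]
      by (auto simp: sets_finite_pos_def intro: less_le_trans)
    moreover have "ennreal ((2 powr p) ^ Suc k) * emeasure M B
        = ennreal (2 powr p) * (ennreal ((2 powr p) ^ k) * emeasure M B)"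
      by (simp add: ennreal_mult mult.assoc)
    moreover have "\<dots> \<le> ennreal (2 powr p) * emeasure M ?A"
      using Suc by (intro mult_left_mono) auto
    ultimately show ?case
      unfolding eq using ge' by (auto intro: order_trans)
  qed
  show ?R
    by (rule uniformly_tends_to_infinity_preimages[OF q n(1)]) (use growth in auto)
next
  assume ?R
  then obtain n where n: "1 \<le> n"
    "\<And>m B. n \<le> m \<Longrightarrow> B \<in> sets_finite_pos M \<Longrightarrow>
      ennreal (2 powr p) < emeasure M ((f ^^ m) -` B \<inter> space M) / emeasure M B"
    unfolding uniformly_tends_to_infinity_def by (metis powr_gt_zero zero_neq_numeral)
  interpret composition_family M p "{n}" "\<lambda>n. f ^^ n"
    by (rule composition_family_funpow)
  have "expanding_family M p {n} (\<lambda>n. f ^^ n)"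
  \<comment> \<open>With a single index the sum has one term and the required factor is just
    \<open>2 powr p\<close>.\<close>
  proof (rule expanding_familyI_sum)
    fix A assume "A \<in> sets_finite_pos M"
    then show "ennreal (real (card {n}) * 2 powr p) * emeasure M A
        \<le> (\<Sum>i\<in>{n}. emeasure M ((f ^^ i) -` A \<inter> space M))"
      using n(2)[of n A] by (auto simp: sets_finite_pos_def intro: ratio_ge_imp_le)
  qed auto
  then show ?L
    using n(1)
    by (auto simp: uniformly_positively_expansive_def expanding_family_def composition_operator_funpow)
qed

end


section \<open>Two-sided expansivity\<close>

context invertible_composition_dynamical_system
begin

abbreviation "f_inv \<equiv> inv_into (space M) f"

lemma bij_betw_space: "bij_betw f (space M) (space M)"
  using inj_on_space surj_on_space by (simp add: bij_betw_def)

text \<open>Each one-sided result thereby applies to the inverse map as well, so backward iterates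
  are treated like forward ones.\<close>

sublocale inverse: composition_dynamical_system M f_inv p
  by (rule inverse_system)

lemma zpow_system: "composition_dynamical_system M (zpow_on (space M) f n) p"
  by (simp add: zpow_on_def funpow_system inverse.funpow_system)

lemma composition_family_zpow: "composition_family M p I (zpow_on (space M) f)"
  by (intro composition_family.intro composition_family_axioms.intro
      sigma_finite_measure_axioms p_ge_1 zpow_system)

text \<open>On the carrier the set-theoretic inverse of the operator agrees with composition by
  \<open>f_inv\<close>. The agreement is known only there, so the iterates must be kept inside
  it.\<close>

lemma composition_operator_zpow:
  assumes "u \<in> Lp_space M p"
  shows "zpow_on (Lp_space M p) (composition_operator M p f) n u
    = composition_operator M p (zpow_on (space M) f n) u"
proof -
  let ?V = "Lp_space M p" and ?T = "composition_operator M p f" and ?S = "composition_operator M p f_inv"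
  have "inv_into ?V ?T v = ?S v" if "v \<in> ?V" for v
    using that inv_into_f_f[OF bij_betw_imp_inj_on[OF bij_betw_composition_operator], of "?S v"]
    by (simp add: composition_operator_inverse inverse.composition_operator_in_Lp_space)
  moreover have S: "(?S ^^ k) u \<in> ?V" for k
    by (induction k) (auto simp: assms inverse.composition_operator_in_Lp_space)
  ultimately have "(inv_into ?V ?T ^^ k) u = (?S ^^ k) u" for k
    by (induction k) auto
  then show ?thesis
    using assms by (simp add: zpow_on_def composition_operator_funpow inverse.composition_operator_funpow)
qed

lemma f_inv_funpow:
  assumes "x \<in> space M"
  shows "(f_inv ^^ n) ((f ^^ n) x) = x" "(f ^^ n) ((f_inv ^^ n) x) = x"
  using zpow_on_add[OF bij_betw_space assms, of "- int n" "int n"]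
    zpow_on_add[OF bij_betw_space assms, of "int n" "- int n"]
  \<comment> \<open>At \<open>n = 0\<close> the exponent \<open>- int n\<close> is nonnegative and
    selects the other branch of \<open>zpow_on\<close>.\<close>
  by (cases "n = 0"; simp add: zpow_on_def)+

text \<open>Forward images become preimages under the inverse, so their growth can be studied
  through composition with \<open>f_inv\<close>.\<close>

lemma image_funpow:
  assumes "B \<in> sets M"
  shows "(f ^^ n) ` B = (f_inv ^^ n) -` B \<inter> space M"
proof (intro set_eqI iffI)
  fix x assume "x \<in> (f ^^ n) ` B"
  then show "x \<in> (f_inv ^^ n) -` B \<inter> space M"
    using sets.sets_into_space[OF assms] f_inv_funpow funpow_space by (auto simp: subset_iff)
next
  fix x assume "x \<in> (f_inv ^^ n) -` B \<inter> space M"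
  then show "x \<in> (f ^^ n) ` B"
    using f_inv_funpow(2)[of x n] by (intro image_eqI[of _ _ "(f_inv ^^ n) x"]) auto
qed

lemma zpreimage_eq_vimage:
  "B \<in> sets M \<Longrightarrow> zpreimage M f n B = zpow_on (space M) f n -` B \<inter> space M"
  by (simp add: zpreimage_def zpow_on_def image_funpow)

text \<open>The integer iterates form a group, so repeated expansion may change direction at every
  step and still amount to one member of the family.\<close>

lemma expansive_iff_SUP:
  "expansive (Lp_space M p) (Lp_norm M p) (composition_operator M p f) \<longleftrightarrow>
    (\<forall>B\<in>sets M. 0 < emeasure M B \<longrightarrow> (SUP n::int. emeasure M (zpreimage M f n B)) = \<infinity>)"
proof -
  interpret composition_family M p UNIV "zpow_on (space M) f"
    by (rule composition_family_zpow)
  have "expansive (Lp_space M p) (Lp_norm M p) (composition_operator M p f) \<longleftrightarrow>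
      expanding_family M p UNIV (zpow_on (space M) f)"
    by (simp add: expansive_def expanding_family_def composition_operator_zpow)
  moreover have "\<exists>k\<in>UNIV. \<forall>x\<in>space M. zpow_on (space M) f k x
      = zpow_on (space M) f i (zpow_on (space M) f j x)" for i j
    using zpow_on_add[OF bij_betw_space] by blast
  ultimately have "expansive (Lp_space M p) (Lp_norm M p) (composition_operator M p f) \<longleftrightarrow>
      (\<forall>B\<in>sets M. 0 < emeasure M B \<longrightarrow>
        (SUP n. emeasure M (zpow_on (space M) f n -` B \<inter> space M)) = \<infinity>)"
    using expanding_family_SUP expanding_familyI_SUP by blast
  then show ?thesis
    by (simp add: zpreimage_eq_vimage)
qed

lemma uniformly_expansive_iff_expanding_family:
  "uniformly_expansive (Lp_space M p) (Lp_norm M p) (composition_operator M p f) \<longleftrightarrow>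
    (\<exists>n::nat. 1 \<le> n \<and> expanding_family M p {int n, - int n} (zpow_on (space M) f))"
  by (simp add: uniformly_expansive_def expanding_family_def composition_operator_zpow)

lemma uniformly_expansive_iff:
  "uniformly_expansive (Lp_space M p) (Lp_norm M p) (composition_operator M p f) \<longleftrightarrow>
    (\<exists>\<A> \<C>. sets_finite_pos M = \<A> \<union> \<C>
      \<and> uniformly_tends_to_infinity \<A> (\<lambda>n B. emeasure M ((f ^^ n) ` B) / emeasure M B)
      \<and> uniformly_tends_to_infinity \<C>
          (\<lambda>n B. emeasure M ((f ^^ n) -` B \<inter> space M) / emeasure M B))"
    (is "?L \<longleftrightarrow> ?R")
proof
  have q: "1 < 2 powr p"
    using p_ge_1 powr_mono[of 1 p 2] by simp
  assume ?L
  then obtain n where n: "1 \<le> n" "expanding_family M p {int n, - int n} (zpow_on (space M) f)"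
    unfolding uniformly_expansive_iff_expanding_family by blast
  interpret composition_family M p "{int n, - int n}" "zpow_on (space M) f"
    by (rule composition_family_zpow)
  have zpow: "zpow_on (space M) f (int n) = f ^^ n" "zpow_on (space M) f (- int n) = f_inv ^^ n"
    using n(1) by (auto simp: zpow_on_def)
  \<comment> \<open>\<open>grows f\<close> concerns preimages and leads to \<open>\<C>\<close>;
    \<open>grows f_inv\<close> concerns forward images and leads to \<open>\<A>\<close>.\<close>
  define grows where "grows g B \<longleftrightarrow>
    ennreal (2 powr p) * emeasure M B \<le> emeasure M ((g ^^ n) -` B \<inter> space M)" for g B
  have alt: "grows f B \<or> grows f_inv B" if B: "B \<in> sets_finite_pos M" for B
  proof -
    obtain i where "i \<in> {int n, - int n}" "ennreal (2 powr p) * emeasure M B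
        \<le> emeasure M (zpow_on (space M) f i -` B \<inter> space M)"
      by (rule expanding_familyD[OF n(2) B])
    then show ?thesis
      unfolding grows_def by (metis insertE singletonD zpow)
  qed
  define \<A> where "\<A> = {B \<in> sets_finite_pos M. grows f_inv B}"
  define \<C> where "\<C> = {B \<in> sets_finite_pos M. grows f B}"
  have "uniformly_tends_to_infinity \<C> (\<lambda>m B. emeasure M ((f ^^ m) -` B \<inter> space M) / emeasure M B)"
  proof (rule uniformly_tends_to_infinity_preimages[OF q n(1)])
    \<comment> \<open>The direction of growth is tracked for the pair \<open>f ^^ n\<close> and
      \<open>f_inv ^^ n\<close>, which undo each other.\<close>
    fix k B assume "B \<in> \<C>"
    then have "ennreal ((2 powr p) ^ k) * emeasure M B \<le> emeasure M (((f ^^ n) ^^ k) -` B \<inter> space M)"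
      using alt unfolding grows_def \<C>_def
      by (intro geometric_growth[OF funpow_system f_inv_funpow(2) inverse.funpow_measurable q]) auto
    then show "ennreal ((2 powr p) ^ k) * emeasure M B \<le> emeasure M ((f ^^ (n * k)) -` B \<inter> space M)"
      by (simp add: funpow_mult)
  qed (auto simp: \<C>_def)
  moreover have "uniformly_tends_to_infinity \<A>
      (\<lambda>m B. emeasure M ((f_inv ^^ m) -` B \<inter> space M) / emeasure M B)"
  proof (rule inverse.uniformly_tends_to_infinity_preimages[OF q n(1)])
    fix k B assume "B \<in> \<A>"
    then have "ennreal ((2 powr p) ^ k) * emeasure M B \<le> emeasure M (((f_inv ^^ n) ^^ k) -` B \<inter> space M)"
      using alt unfolding grows_def \<A>_def
      by (intro geometric_growth[OF inverse.funpow_system f_inv_funpow(1) funpow_measurable q]) auto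
    then show "ennreal ((2 powr p) ^ k) * emeasure M B \<le> emeasure M ((f_inv ^^ (n * k)) -` B \<inter> space M)"
      by (simp add: funpow_mult)
  qed (auto simp: \<A>_def)
  then have "uniformly_tends_to_infinity \<A> (\<lambda>m B. emeasure M ((f ^^ m) ` B) / emeasure M B)"
    by (rule uniformly_tends_to_infinity_cong[THEN iffD1, rotated])
      (simp add: \<A>_def sets_finite_pos_def image_funpow)
  moreover have "sets_finite_pos M = \<A> \<union> \<C>"
    using alt by (auto simp: \<A>_def \<C>_def)
  ultimately show ?R by (intro exI[of _ \<A>] exI[of _ \<C>] conjI)
next
  assume ?R
  then obtain \<A> \<C> where AC: "sets_finite_pos M = \<A> \<union> \<C>"
    and A: "uniformly_tends_to_infinity \<A> (\<lambda>n B. emeasure M ((f ^^ n) ` B) / emeasure M B)"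
    and C: "uniformly_tends_to_infinity \<C>
      (\<lambda>n B. emeasure M ((f ^^ n) -` B \<inter> space M) / emeasure M B)"
    by blast
  \<comment> \<open>The factor 2 in front counts the two directions: a set is known to expand in one
    of them only, yet the sum over both must reach twice \<open>2 powr p\<close>.\<close>
  have K: "0 < 2 * 2 powr p" by simp
  obtain nA where nA: "\<And>m B. nA \<le> m \<Longrightarrow> B \<in> \<A> \<Longrightarrow>
      ennreal (2 * 2 powr p) < emeasure M ((f ^^ m) ` B) / emeasure M B"
    using A K unfolding uniformly_tends_to_infinity_def by meson
  obtain nC where nC: "\<And>m B. nC \<le> m \<Longrightarrow> B \<in> \<C> \<Longrightarrow>
      ennreal (2 * 2 powr p) < emeasure M ((f ^^ m) -` B \<inter> space M) / emeasure M B"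
    using C K unfolding uniformly_tends_to_infinity_def by meson
  obtain n where n: "1 \<le> n" "nA \<le> n" "nC \<le> n"
    by (rule that[of "Suc (nA + nC)"]) auto
  have zpow: "zpow_on (space M) f (int n) = f ^^ n" "zpow_on (space M) f (- int n) = f_inv ^^ n"
    using n(1) by (auto simp: zpow_on_def)
  \<comment> \<open>Distinct exponents give the index set two elements, hence a sum of two
    terms.\<close>
  have ne: "int n \<noteq> - int n" using n(1) by simp
  interpret composition_family M p "{int n, - int n}" "zpow_on (space M) f"
    by (rule composition_family_zpow)
  have "expanding_family M p {int n, - int n} (zpow_on (space M) f)"
  proof (rule expanding_familyI_sum)
    fix B assume B: "B \<in> sets_finite_pos M"
    then have Bs: "B \<in> sets M" "0 < emeasure M B" "emeasure M B < \<infinity>"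
      by (auto simp: sets_finite_pos_def)
    have "ennreal (2 * 2 powr p) * emeasure M B \<le> emeasure M ((f_inv ^^ n) -` B \<inter> space M)" if "B \<in> \<A>"
      using nA[of n, OF _ that] Bs by (intro ratio_ge_imp_le) (auto simp: n(2) image_funpow)
    moreover have "ennreal (2 * 2 powr p) * emeasure M B \<le> emeasure M ((f ^^ n) -` B \<inter> space M)"
      if "B \<in> \<C>"
      using nC[of n, OF _ that] Bs by (intro ratio_ge_imp_le) (auto simp: n(3))
    moreover have "B \<in> \<A> \<or> B \<in> \<C>"
      using AC B by blast
    \<comment> \<open>The direction that is not controlled contributes a nonnegative term.\<close>
    ultimately have "ennreal (2 * 2 powr p) * emeasure M B
        \<le> emeasure M ((f ^^ n) -` B \<inter> space M) + emeasure M ((f_inv ^^ n) -` B \<inter> space M)"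
      using add_increasing[OF zero_le] add_increasing2[OF zero_le] by metis
    then show "ennreal (real (card {int n, - int n}) * 2 powr p) * emeasure M B
        \<le> (\<Sum>i\<in>{int n, - int n}. emeasure M (zpow_on (space M) f i -` B \<inter> space M))"
      using ne by (simp add: zpow)
  qed auto
  then show ?L
    unfolding uniformly_expansive_iff_expanding_family
    by (intro exI[of _ n] conjI n(1))
qed

end

theorem theoremE:
  fixes M :: "'a measure" and f :: "'a \<Rightarrow> 'a" and p :: real
  assumes "composition_dynamical_system M f p"
  shows
    "(positively_expansive (Lp_space M p) (Lp_norm M p) (composition_operator M p f) \<longleftrightarrow>
        (\<forall>B\<in>sets M. 0 < emeasure M B \<longrightarrow>
           (SUP n\<in>{1::nat..}. emeasure M ((f ^^ n) -` B \<inter> space M)) = \<infinity>))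
     \<and> (invertible_composition_dynamical_system M f p \<longrightarrow>
        (expansive (Lp_space M p) (Lp_norm M p) (composition_operator M p f) \<longleftrightarrow>
          (\<forall>B\<in>sets M. 0 < emeasure M B \<longrightarrow>
             (SUP n::int. emeasure M (zpreimage M f n B)) = \<infinity>)))
     \<and> (uniformly_positively_expansive (Lp_space M p) (Lp_norm M p) (composition_operator M p f) \<longleftrightarrow>
        uniformly_tends_to_infinity (sets_finite_pos M)
          (\<lambda>n B. emeasure M ((f ^^ n) -` B \<inter> space M) / emeasure M B))
     \<and> (invertible_composition_dynamical_system M f p \<longrightarrow>
        (uniformly_expansive (Lp_space M p) (Lp_norm M p) (composition_operator M p f) \<longleftrightarrow>
          (\<exists>\<A> \<C>. sets_finite_pos M = \<A> \<union> \<C>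
             \<and> uniformly_tends_to_infinity \<A>
                 (\<lambda>n B. emeasure M ((f ^^ n) ` B) / emeasure M B)
             \<and> uniformly_tends_to_infinity \<C>
                 (\<lambda>n B. emeasure M ((f ^^ n) -` B \<inter> space M) / emeasure M B))))"
  using composition_dynamical_system.positively_expansive_iff_SUP[OF assms]
    composition_dynamical_system.uniformly_positively_expansive_iff[OF assms]
    invertible_composition_dynamical_system.expansive_iff_SUP[of M f p]
    invertible_composition_dynamical_system.uniformly_expansive_iff[of M f p]
  by blast

end
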